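(* Let $m\in\mathbb{N}$, $x>0$, let $g\in\mathrm{dom}\,\Sigma^{m+1}$, and suppose that the function $f=\Sigma^{m+1}g$ satisfies the following assumptions for $k=0,\ldots,m$: (1) the function $t\mapsto\binom{x-1-t}{k}\,\Delta^{k+1}f(t)$ lies in $\mathrm{dom}\,\Sigma$; (2) the function $t\mapsto\binom{x-t}{k}\,\Delta^kf(t)$ lies in $\mathcal{D}^{p_k}\cap\mathcal{K}^{p_k}$ for some integer $p_k\ge1$. Then $$\Sigma^{m+1}g(x)=\Big[\Sigma_t\,\binom{x-t-1}{m}\,g(t)\Big]_{t=x}.$$
   Context: $\mathbb{N}$ is the set of nonnegative integers, $\mathbb{R}_+=(0,\infty)$, $\Delta f(x)=f(x+1)-f(x)$, and $\binom{x}{j}=x(x-1)\cdots(x-j+1)/j!$ for real $x$ and $j\in\mathbb{N}$. For an integer $p\ge -1$, a function $f$ on a real interval $I$ is $p$-convex if its divided difference $f[x_0,\dots,x_{p+1}]$ is $\ge 0$ at any $p+2$ pairwise distinct points of $I$, and $p$-concave if $-f$ is $p$-convex. For $p\in\mathbb{N}$, $\mathcal{D}^p$ is the set of functions $f\colon\mathbb{R}_+\to\mathbb{R}$ such that $\Delta^pf(n)\to0$ as the integer $n\to\infty$. For an integer $p\ge-1$, $\mathcal{K}^p$ is the set of functions $f\colon\mathbb{R}_+\to\mathbb{R}$ that are eventually $p$-convex or eventually $p$-concave (i.e. $p$-convex, or $p$-concave, on some half-line $(M,\infty)$). Definition of $\Sigma$ (known well-definedness): $\mathrm{dom}\,\Sigma=\bigcup_{p\ge0}(\mathcal{D}^p\cap\mathcal{K}^p)$.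 If $g\in\mathcal{D}^p\cap\mathcal{K}^p$, then $\Sigma g\colon\mathbb{R}_+\to\mathbb{R}$ is the unique solution $f\in\mathcal{K}^p$ of $\Delta f=g$ on $\mathbb{R}_+$ with $f(1)=0$; it is given by the pointwise limit $$\Sigma g(x)=\lim_{n\to\infty}\Big(\sum_{k=1}^{n-1}g(k)-\sum_{k=0}^{n-1}g(x+k)+\sum_{j=1}^p\binom{x}{j}\Delta^{j-1}g(n)\Big),$$ and it does not depend on the choice of $p$. Iterates: $\Sigma^0=\mathrm{id}$, $\Sigma^{m+1}=\Sigma\circ\Sigma^m$; $g\in\mathrm{dom}\,\Sigma^{m+1}$ means $g\in\mathrm{dom}\,\Sigma^m$ and $\Sigma^mg\in\mathrm{dom}\,\Sigma$. The notation $[\Sigma_t\,h(t)]_{t=c}$ means $(\Sigma h)(c)$, where $h$ is the whole expression following $\Sigma_t$ viewed as a function of $t\in\mathbb{R}_+$ (with $x$ fixed). *)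

theory Defs
  imports "HOL-Analysis.Analysis"
begin

text \<open>Functions on the half-line \<open>(0, \<infinity>)\<close> are represented by total functions on the reals. The classes
  \<open>D_class\<close>, \<open>K_class\<close> and the operator \<open>indef_sum\<close> depend only on the values at positive arguments.\<close>

definition fwd_diff :: "(real \<Rightarrow> real) \<Rightarrow> real \<Rightarrow> real" where
  "fwd_diff f x = f (x + 1) - f x"

text \<open>The divided difference at the points of a finite set \<open>A\<close>. It is symmetric in its points, so pairwise
  distinct points can be given as a set. The lemma \<open>divided_diff_insert\<close> is the usual recursion.\<close>

definition divided_diff :: "(real \<Rightarrow> real) \<Rightarrow> real set \<Rightarrow> real" where
  "divided_diff f A = (\<Sum>x\<in>A. f x / (\<Prod>y\<in>A - {x}. x - y))"

lemma divided_diff_singleton: "divided_diff f {x} = f x"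
  by (simp add: divided_diff_def)

lemma divided_diff_insert:
  assumes "finite A" "a \<notin> A" "b \<notin> A" "a \<noteq> b"
  shows "divided_diff f (insert a (insert b A)) =
    (divided_diff f (insert a A) - divided_diff f (insert b A)) / (a - b)"
proof -
  define P where "P x = (\<Prod>y\<in>A - {x}. x - y)" for x
  define S where "S c d = (\<Sum>x\<in>A. f x / (P x * ((x - c) * (x - d))))" for c d
  have D: "divided_diff f (insert c A) = f c / P c + (\<Sum>x\<in>A. f x / ((x - c) * P x))"
    if "c \<notin> A" for c
  proof -
    have "insert c A - {x} = insert c (A - {x})" if "x \<in> A" for x
      using that \<open>c \<notin> A\<close> by auto
    then show ?thesis
      using assms(1) that by (simp add: divided_diff_def P_def)
  qed
  have S: "(\<Sum>x\<in>A. f x / ((x - a) * P x)) - (\<Sum>x\<in>A. f x / ((x - b) * P x)) = (a - b) * S a b"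
    unfolding S_def sum_distrib_left sum_subtractf [symmetric]
  proof (rule sum.cong)
    fix x assume x: "x \<in> A"
    then have "x - a \<noteq> 0" "x - b \<noteq> 0" "P x \<noteq> 0"
      using assms by (auto simp: P_def)
    then show "f x / ((x - a) * P x) - f x / ((x - b) * P x) =
        (a - b) * (f x / (P x * ((x - a) * (x - b))))"
      by (simp add: divide_simps) (simp add: algebra_simps)
  qed simp
  have "divided_diff f (insert a (insert b A)) =
      f a / ((a - b) * P a) + f b / ((b - a) * P b) + S a b"
  proof -
    have "insert a (insert b A) - {x} = insert a (insert b (A - {x}))" if "x \<in> A" for x
      using that assms by auto
    moreover have "insert a (insert b A) - {a} = insert b (A - {a})"
      "insert a (insert b A) - {b} = insert a (A - {b})"
      using assms by auto
    ultimately show ?thesis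
      using assms by (simp add: divided_diff_def P_def S_def mult_ac)
  qed
  moreover have "(f a / P a - f b / P b + (a - b) * S a b) / (a - b) =
      f a / ((a - b) * P a) + f b / ((b - a) * P b) + S a b"
  proof -
    have "P a \<noteq> 0" "P b \<noteq> 0" "a - b \<noteq> 0" "b - a \<noteq> 0"
      using assms by (auto simp: P_def)
    then show ?thesis
      by (simp add: divide_simps) (simp add: algebra_simps)
  qed
  moreover have "divided_diff f (insert a A) - divided_diff f (insert b A) =
      f a / P a - f b / P b + (a - b) * S a b"
    using D[of a] D[of b] S assms by simp
  ultimately show ?thesis
    by simp
qed

definition p_convex_on :: "int \<Rightarrow> real set \<Rightarrow> (real \<Rightarrow> real) \<Rightarrow> bool" where
  "p_convex_on p I f \<longleftrightarrow>
    (\<forall>A. finite A \<and> A \<subseteq> I \<and> int (card A) = p + 2 \<longrightarrow> divided_diff f A \<ge> 0)"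

definition p_concave_on :: "int \<Rightarrow> real set \<Rightarrow> (real \<Rightarrow> real) \<Rightarrow> bool" where
  "p_concave_on p I f \<longleftrightarrow> p_convex_on p I (\<lambda>x. - f x)"

definition D_class :: "nat \<Rightarrow> (real \<Rightarrow> real) set" where
  "D_class p = {f. (\<lambda>n::nat. (fwd_diff ^^ p) f (real n)) \<longlonglongrightarrow> 0}"

text \<open>Only \<open>p \<ge> - 1\<close> is meaningful.\<close>

definition K_class :: "int \<Rightarrow> (real \<Rightarrow> real) set" where
  "K_class p = {f. \<exists>M\<ge>0. p_convex_on p {M<..} f \<or> p_concave_on p {M<..} f}"

definition dom_indef_sum :: "(real \<Rightarrow> real) set" where
  "dom_indef_sum = (\<Union>p::nat. D_class p \<inter> K_class (int p))"

text \<open>The operator \<open>\<Sigma>\<close>: for \<open>g\<close> in \<open>D_class p \<inter> K_class p\<close>, the unique solution \<open>f\<close> in \<open>K_class p\<close> on the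
  positive half-line of \<open>\<Delta> f = g\<close> with \<open>f 1 = 0\<close>; it does not depend on \<open>p\<close>. Prescribing the
  value \<open>0\<close> at nonpositive arguments makes the total function representing \<open>f\<close> unique.\<close>

definition indef_sum :: "(real \<Rightarrow> real) \<Rightarrow> real \<Rightarrow> real" where
  "indef_sum g = (THE f.
    (\<exists>p::nat. g \<in> D_class p \<inter> K_class (int p) \<and> f \<in> K_class (int p)) \<and>
    (\<forall>x>0. fwd_diff f x = g x) \<and> f 1 = 0 \<and> (\<forall>x\<le>0. f x = 0))"

primrec dom_indef_sum_iter :: "nat \<Rightarrow> (real \<Rightarrow> real) set" where
  "dom_indef_sum_iter 0 = UNIV"
| "dom_indef_sum_iter (Suc m) =
    {g \<in> dom_indef_sum_iter m. (indef_sum ^^ m) g \<in> dom_indef_sum}"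

end

theory Submission
  imports Defs
begin

text \<open>The right-hand side is a repeated summation by parts. Put
  \<open>h k t = (x - t gchoose k) \<cdot> \<Delta>\<^sup>k f t\<close> and \<open>u t = (x - 1 - t gchoose m) \<cdot> \<Delta>\<^sup>m\<^sup>+\<^sup>1 f t\<close>. By Pascal's rule the
  differences \<open>\<Delta> (h 0), \<dots>, \<Delta> (h m)\<close> add up to \<open>u\<close> (\<open>sum_fwd_diff_gbinomial_mult\<close>), and \<open>u\<close> is the
  integrand on the right because \<open>\<Delta>\<^sup>m\<^sup>+\<^sup>1 f = g\<close>. Summing gives \<open>\<Sigma>u (x)\<close> as the sum of all
  \<open>h k x - h k 1\<close>. Here \<open>h k x = 0\<close> for \<open>k > 0\<close>, since the binomial coefficient is \<open>0 gchoose k\<close>, and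
  \<open>h k 1 = 0\<close>, since \<open>\<Delta>\<^sup>k f\<close> is a value of \<open>\<Sigma>\<close>; what remains is \<open>h 0 x = f x\<close>.

  The operator \<open>\<Sigma>\<close> is not obviously additive, because the orders \<open>p\<close> of the summands differ. So the
  summation is done before the limit, with the approximants of \<open>\<Sigma>g\<close>: they are linear in \<open>g\<close>, and
  raising their order does not change the limit (\<open>indef_sum_approx_tendsto_mono\<close>). For the summands,
  \<open>indef_sum_approx_tendsto_antidifference\<close> says that the approximants of \<open>\<Delta> h\<close> converge to
  \<open>h x - h 1\<close>.

  That lemma is also the uniqueness half of the fact that \<open>\<Sigma>\<close> is well-defined; the existence half is
  \<open>indef_sum_solution_exists\<close>. Both rest on one estimate, \<open>newton_rem_bound\<close>: for an eventually
  \<open>p\<close>-convex \<open>f\<close>, the remainder of Newton's interpolation formula with nodes \<open>n, \<dots>, n + p\<close> is bounded by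
  a multiple of the increment of \<open>\<Delta>\<^sup>p f\<close> over an interval of fixed length near \<open>n\<close>, because divided
  differences of order \<open>p\<close> are monotone in their nodes. Such increments tend to \<open>0\<close> if \<open>\<Delta>\<^sup>p\<^sup>+\<^sup>1 f\<close> does,
  and are summable if \<open>\<Delta>\<^sup>p f\<close> tends to \<open>0\<close>. The remainder of \<open>f\<close> is the error of the approximants if
  \<open>\<Delta> f = g\<close> is known to have the solution \<open>f\<close>; the remainder of \<open>g\<close> is the difference of consecutive
  approximants.\<close>

section \<open>Iterated forward differences\<close>

lemma fwd_diff_funpow_Suc:
  "(fwd_diff ^^ Suc j) f x = (fwd_diff ^^ j) f (x + 1) - (fwd_diff ^^ j) f x"
  by (simp add: fwd_diff_def)

lemma fwd_diff_funpow_fwd_diff: "(fwd_diff ^^ j) (fwd_diff f) = (fwd_diff ^^ Suc j) f"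
  by (simp add: funpow_swap1)

lemma fwd_diff_funpow_uminus: "(fwd_diff ^^ j) (\<lambda>t. - f t) x = - (fwd_diff ^^ j) f x"
  by (induction j arbitrary: x) (simp_all add: fwd_diff_def)

lemma fwd_diff_funpow_sum:
  "(fwd_diff ^^ j) (\<lambda>t. \<Sum>k\<in>S. h k t) x = (\<Sum>k\<in>S. (fwd_diff ^^ j) (h k) x)"
  by (induction j arbitrary: x) (simp_all add: fwd_diff_def sum_subtractf)

lemma fwd_diff_funpow_cong:
  assumes "\<And>t. t > 0 \<Longrightarrow> f t = g t" and "x > 0"
  shows "(fwd_diff ^^ j) f x = (fwd_diff ^^ j) g x"
  using assms(2) by (induction j arbitrary: x) (simp_all add: assms(1) fwd_diff_def)

lemma fwd_diff_mem_D_class: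
  assumes "f \<in> D_class p"
  shows "fwd_diff f \<in> D_class p"
proof -
  have lim: "(\<lambda>n. (fwd_diff ^^ p) f (real n)) \<longlonglongrightarrow> 0"
    using assms by (simp add: D_class_def)
  have "(\<lambda>n. (fwd_diff ^^ p) f (real (Suc n)) - (fwd_diff ^^ p) f (real n)) \<longlonglongrightarrow> 0 - 0"
    by (intro tendsto_diff lim LIMSEQ_Suc)
  then show ?thesis
    by (simp add: D_class_def fwd_diff_funpow_fwd_diff fwd_diff_funpow_Suc add.commute
        del: funpow.simps)
qed

lemma D_class_mono:
  assumes "p \<le> q"
  shows "D_class p \<subseteq> D_class q"
  using assms
proof (induction q rule: dec_induct)
  case (step q)
  have "D_class q \<subseteq> D_class (Suc q)"
    using fwd_diff_mem_D_class
    by (auto simp: D_class_def fwd_diff_funpow_fwd_diff simp del: funpow.simps)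
  with step.IH show ?case
    by blast
qed simp

lemma D_class_cong:
  assumes "\<And>t. t > 0 \<Longrightarrow> f t = g t"
  shows "f \<in> D_class p \<longleftrightarrow> g \<in> D_class p"
proof -
  have "\<forall>\<^sub>F n in sequentially. (fwd_diff ^^ p) f (real n) = (fwd_diff ^^ p) g (real n)"
    using eventually_gt_at_top[of 0]
    by eventually_elim (auto intro: fwd_diff_funpow_cong assms)
  then show ?thesis
    unfolding D_class_def mem_Collect_eq by (rule tendsto_cong)
qed

section \<open>Divided differences\<close>

lemma divided_diff_uminus: "divided_diff (\<lambda>x. - f x) A = - divided_diff f A"
  by (simp add: divided_diff_def sum_negf)

lemma divided_diff_add: "divided_diff (\<lambda>x. f x + g x) A = divided_diff f A + divided_diff g A"
  by (simp add: divided_diff_def add_divide_distrib sum.distrib)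

lemma divided_diff_cmult: "divided_diff (\<lambda>x. c * f x) A = c * divided_diff f A"
  by (simp add: divided_diff_def sum_distrib_left)

lemma divided_diff_sum: "divided_diff (\<lambda>x. \<Sum>k\<in>S. f k x) A = (\<Sum>k\<in>S. divided_diff (f k) A)"
  unfolding divided_diff_def sum_divide_distrib by (rule sum.swap)

lemma divided_diff_translate:
  "divided_diff (\<lambda>x. f (x + c)) A = divided_diff f ((\<lambda>x. x + c) ` A)"
proof -
  have inj: "inj_on (\<lambda>x. x + c) B" for B
    by simp
  have "(\<Prod>y\<in>(\<lambda>x. x + c) ` A - {x + c}. x + c - y) = (\<Prod>y\<in>A - {x}. x - y)" for x
  proof -
    have "(\<lambda>x. x + c) ` A - {x + c} = (\<lambda>x. x + c) ` (A - {x})"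
      by auto
    then show ?thesis
      by (simp add: prod.reindex[OF inj])
  qed
  then show ?thesis
    by (simp add: divided_diff_def sum.reindex[OF inj])
qed

lemma divided_diff_cong:
  assumes "\<And>x. x \<in> A \<Longrightarrow> f x = g x"
  shows "divided_diff f A = divided_diff g A"
  using assms by (simp add: divided_diff_def)

lemma tendsto_divided_diff:
  assumes "\<And>x. x \<in> A \<Longrightarrow> (\<lambda>n. F n x) \<longlonglongrightarrow> f x"
  shows "(\<lambda>n. divided_diff (F n) A) \<longlonglongrightarrow> divided_diff f A"
  unfolding divided_diff_def divide_inverse by (intro tendsto_intros assms)

lemma divided_diff_const:
  assumes "card A \<ge> 2"
  shows "divided_diff (\<lambda>x. c) A = 0"
proof -
  have "finite A"
    using assms card.infinite by fastforce
  then show ?thesis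
    using assms
  proof (induction "card A" arbitrary: A rule: less_induct)
    case less
    obtain a A' where A': "A = insert a A'" "a \<notin> A'"
      using less.prems by (metis card.empty ex_in_conv mk_disjoint_insert not_numeral_le_zero)
    with less.prems obtain b B where B: "A' = insert b B" "b \<notin> B"
      by (metis card_1_singleton_iff ex_in_conv mk_disjoint_insert numeral_le_one_iff
          semiring_norm(69) One_nat_def)
    have ab: "A = insert a (insert b B)" "a \<notin> B" "b \<notin> B" "a \<noteq> b" "finite B"
      using A' B less.prems by auto
    have "divided_diff (\<lambda>x. c) (insert a B) = divided_diff (\<lambda>x. c) (insert b B)"
    proof (cases "B = {}")
      case True
      then show ?thesis
        by (simp add: divided_diff_singleton)
    next
      case False
      then have "card B \<ge> 1"
        using ab by (simp add: Suc_le_eq card_gt_0_iff)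
      then have "card (insert a B) \<ge> 2" "card (insert b B) \<ge> 2"
          "card (insert a B) < card A" "card (insert b B) < card A"
        using ab by auto
      then show ?thesis
        using less.hyps ab by simp
    qed
    then show ?case
      using divided_diff_insert[of B a b] ab by simp
  qed
qed

lemma divided_diff_linear_factor:
  assumes "finite B" "a \<notin> B"
  shows "divided_diff (\<lambda>x. (x - a) * f x) (insert a B) = divided_diff f B"
proof -
  have "insert a B - {x} = insert a (B - {x})" if "x \<in> B" for x
    using that assms by auto
  moreover have "x - a \<noteq> 0" if "x \<in> B" for x
    using that assms by auto
  ultimately show ?thesis
    using assms by (simp add: divided_diff_def)
qed

text \<open>The function is a polynomial of degree \<open>j\<close>. Trading a linear factor \<open>x - j\<close> for \<open>x - a\<close> with a
  node \<open>a\<close> lowers degree and number of nodes together.\<close>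

lemma divided_diff_gbinomial:
  assumes "card A \<ge> j + 2"
  shows "divided_diff (\<lambda>x. x gchoose j) A = 0"
  using assms
proof (induction j arbitrary: A)
  case 0
  then show ?case
    by (simp add: divided_diff_const)
next
  case (Suc j)
  have fin: "finite A"
    using Suc.prems card.infinite by fastforce
  obtain a B where B: "A = insert a B" "a \<notin> B"
    using Suc.prems by (metis add_is_0 card.empty ex_in_conv le_zero_eq mk_disjoint_insert
        zero_neq_numeral)
  have B2: "finite B" "card B \<ge> j + 2"
    using B fin Suc.prems by auto
  have "(\<lambda>x::real. x gchoose Suc j) = (\<lambda>x. 1 / real (Suc j) *
      ((x - a) * (x gchoose j) + (a - real j) * (x gchoose j)))"
  proof
    fix x :: real
    have "real (Suc j) * (x gchoose Suc j) = (x - real j) * (x gchoose j)"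
      using gbinomial_mult_1[of x j] by (simp add: algebra_simps)
    then show "(x gchoose Suc j) = 1 / real (Suc j) *
        ((x - a) * (x gchoose j) + (a - real j) * (x gchoose j))"
      by (simp add: field_simps)
  qed
  then have "divided_diff (\<lambda>x. x gchoose Suc j) A = 1 / real (Suc j) *
      (divided_diff (\<lambda>x. (x - a) * (x gchoose j)) A + (a - real j) * divided_diff (\<lambda>x. x gchoose j) A)"
    by (simp only: divided_diff_cmult divided_diff_add)
  also have "divided_diff (\<lambda>x. (x - a) * (x gchoose j)) A = divided_diff (\<lambda>x. x gchoose j) B"
    using B B2 by (simp add: divided_diff_linear_factor)
  also have "\<dots> = 0"
    using Suc.IH[OF B2(2)] .
  also have "divided_diff (\<lambda>x. x gchoose j) A = 0"
    by (rule Suc.IH) (use Suc.prems in simp)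
  finally show ?case
    by simp
qed

text \<open>By the recursion, moving one node of a divided difference of order \<open>p\<close> to the right changes it by a
  positive multiple of a divided difference of order \<open>p + 1\<close>. So the nodes in \<open>A\<close> are moved into \<open>B\<close> one
  after the other; \<open>C\<close> holds those that have already been moved.\<close>

lemma p_convex_divided_diff_mono_aux:
  assumes "p_convex_on (int p) I f" "finite A" "finite B" "finite C" "A \<union> B \<union> C \<subseteq> I"
    and "card A = card B" "card A + card C = Suc p" "\<And>a b. a \<in> A \<Longrightarrow> b \<in> B \<Longrightarrow> a < b"
    and "A \<inter> C = {}" "B \<inter> C = {}"
  shows "divided_diff f (A \<union> C) \<le> divided_diff f (B \<union> C)"
  using assms(2-)
proof (induction "card A" arbitrary: A B C)
  case 0
  then show ?case
    by simp
next
  case (Suc k)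
  obtain a A' where A': "A = insert a A'" "a \<notin> A'"
    using Suc.hyps(2) by (metis card_eq_SucD)
  obtain b B' where B': "B = insert b B'" "b \<notin> B'"
    using Suc.hyps(2) Suc.prems(5) by (metis card_eq_SucD)
  have fin: "finite A'" "finite B'"
    using Suc.prems A' B' by auto
  have "a < b" "b \<notin> A'"
    using Suc.prems(7) A' B' by auto
  have notin: "a \<notin> A' \<union> C" "b \<notin> A' \<union> C"
    using A' B' \<open>b \<notin> A'\<close> Suc.prems by auto
  define D where "D = A' \<union> C"
  have D: "finite D" "a \<notin> D" "b \<notin> D"
    using fin Suc.prems notin by (auto simp: D_def)
  have "card D = p"
    using Suc.prems(6,8) A' fin Suc.prems(3) by (simp add: D_def card_Un_disjoint)
  then have "int (card (insert b (insert a D))) = int p + 2"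
    using D \<open>a < b\<close> by simp
  moreover have "insert b (insert a D) \<subseteq> I"
    using Suc.prems A' B' by (auto simp: D_def)
  ultimately have nonneg: "0 \<le> divided_diff f (insert b (insert a D))"
    using assms(1) D(1) unfolding p_convex_on_def by simp
  have "divided_diff f (insert b (insert a D)) =
      (divided_diff f (insert b D) - divided_diff f (insert a D)) / (b - a)"
    using D \<open>a < b\<close> by (intro divided_diff_insert) auto
  with nonneg \<open>a < b\<close> have "divided_diff f (insert a D) \<le> divided_diff f (insert b D)"
    by (simp add: zero_le_divide_iff)
  moreover have "divided_diff f (A' \<union> insert b C) \<le> divided_diff f (B' \<union> insert b C)"
  proof (rule Suc.hyps(1))
    show "k = card A'" "card A' = card B'" "card A' + card (insert b C) = Suc p"
      using Suc.hyps(2) Suc.prems A' B' fin notin by auto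
  qed (use Suc.prems A' B' fin notin in auto)
  ultimately show ?case
    by (simp add: A'(1) B'(1) D_def)
qed

lemma p_convex_divided_diff_mono:
  assumes "p_convex_on (int p) I f" "finite A" "finite B" "A \<subseteq> I" "B \<subseteq> I"
    and "card A = Suc p" "card B = Suc p" "\<And>a b. a \<in> A \<Longrightarrow> b \<in> B \<Longrightarrow> a < b"
  shows "divided_diff f A \<le> divided_diff f B"
  using p_convex_divided_diff_mono_aux[of p I f A B "{}"] assms by simp

lemma p_convex_on_cong:
  assumes "\<And>t. t \<in> I \<Longrightarrow> f t = g t"
  shows "p_convex_on p I f \<longleftrightarrow> p_convex_on p I g"
proof -
  have "divided_diff f A = divided_diff g A" if "A \<subseteq> I" for A
    using that assms by (intro divided_diff_cong) auto
  then show ?thesis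
    unfolding p_convex_on_def by metis
qed

lemma K_class_cong:
  assumes "\<And>t. t > 0 \<Longrightarrow> f t = g t"
  shows "f \<in> K_class p \<longleftrightarrow> g \<in> K_class p"
proof -
  have "p_convex_on p {M<..} f \<longleftrightarrow> p_convex_on p {M<..} g"
    "p_convex_on p {M<..} (\<lambda>t. - f t) \<longleftrightarrow> p_convex_on p {M<..} (\<lambda>t. - g t)" if "M \<ge> 0" for M
    using that assms by (auto intro!: p_convex_on_cong)
  then show ?thesis
    unfolding K_class_def p_concave_on_def by auto
qed

section \<open>The remainder of Newton's interpolation formula\<close>

definition grid :: "real \<Rightarrow> nat \<Rightarrow> real set" where
  "grid a p = (\<lambda>i. a + real i) ` {..<p}"

lemma grid_Suc: "grid a (Suc p) = insert (a + real p) (grid a p)"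
  by (simp add: grid_def lessThan_Suc)

lemma grid_Suc_shift: "grid a (Suc p) = insert a (grid (a + 1) p)"
  by (simp add: grid_def lessThan_Suc_eq_insert_0 image_image add.assoc)

lemma finite_grid: "finite (grid a p)"
  by (simp add: grid_def)

lemma card_grid: "card (grid a p) = p"
  by (simp add: grid_def card_image inj_on_def)

lemma divided_diff_grid: "divided_diff f (grid a (Suc p)) = (fwd_diff ^^ p) f a / fact p"
proof (induction p arbitrary: a)
  case 0
  then show ?case
    by (simp add: grid_def divided_diff_singleton lessThan_Suc)
next
  case (Suc p)
  have "grid a (Suc (Suc p)) = insert (a + 1 + real p) (insert a (grid (a + 1) p))"
    by (simp add: grid_Suc_shift[of a "Suc p"] grid_Suc[of "a + 1"] insert_commute)
  also have "divided_diff f \<dots> = (divided_diff f (insert (a + 1 + real p) (grid (a + 1) p))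
      - divided_diff f (insert a (grid (a + 1) p))) / (a + 1 + real p - a)"
    by (rule divided_diff_insert) (auto simp: grid_def)
  also have "\<dots> = ((fwd_diff ^^ p) f (a + 1) / fact p - (fwd_diff ^^ p) f a / fact p) / real (Suc p)"
    unfolding grid_Suc[symmetric] grid_Suc_shift[symmetric] Suc.IH by simp
  also have "\<dots> = (fwd_diff ^^ Suc p) f a / fact (Suc p)"
    by (simp add: fwd_diff_funpow_Suc diff_divide_distrib mult.commute del: funpow.simps)
  finally show ?case .
qed

text \<open>The error at \<open>a + x\<close> when \<open>f\<close> is replaced by its interpolation polynomial with nodes
  \<open>a, a + 1, \<dots>, a + p - 1\<close>.\<close>

definition newton_rem :: "nat \<Rightarrow> (real \<Rightarrow> real) \<Rightarrow> real \<Rightarrow> real \<Rightarrow> real" where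
  "newton_rem p f a x = f (a + x) - (\<Sum>j<p. (x gchoose j) * (fwd_diff ^^ j) f a)"

lemma newton_rem_Suc:
  "newton_rem (Suc p) f a x = newton_rem p f a x - (x gchoose p) * (fwd_diff ^^ p) f a"
  by (simp add: newton_rem_def)

lemma newton_rem_uminus: "newton_rem p (\<lambda>t. - f t) a x = - newton_rem p f a x"
  by (simp add: newton_rem_def fwd_diff_funpow_uminus sum_negf)

lemma newton_rem_Suc_shift:
  "newton_rem (Suc p) f a (x + 1) = newton_rem (Suc p) f a x + newton_rem p (fwd_diff f) a x"
proof -
  have "(\<Sum>j<Suc p. (x + 1 gchoose j) * (fwd_diff ^^ j) f a) =
      f a + (\<Sum>j<p. (x + 1 gchoose Suc j) * (fwd_diff ^^ Suc j) f a)"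
    by (simp add: sum.lessThan_Suc_shift del: sum.lessThan_Suc)
  also have "\<dots> = (f a + (\<Sum>j<p. (x gchoose Suc j) * (fwd_diff ^^ Suc j) f a))
      + (\<Sum>j<p. (x gchoose j) * (fwd_diff ^^ Suc j) f a)"
    unfolding gbinomial_Suc_Suc distrib_right sum.distrib by (simp del: funpow.simps)
  also have "f a + (\<Sum>j<p. (x gchoose Suc j) * (fwd_diff ^^ Suc j) f a) =
      (\<Sum>j<Suc p. (x gchoose j) * (fwd_diff ^^ j) f a)"
    by (simp add: sum.lessThan_Suc_shift del: sum.lessThan_Suc)
  finally show ?thesis
    by (simp add: newton_rem_def fwd_diff_funpow_fwd_diff fwd_diff_def[of f "a + x"] add.assoc
        del: funpow.simps sum.lessThan_Suc)
qed

lemma newton_rem_node: "k < p \<Longrightarrow> newton_rem p f a (real k) = 0"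
proof (induction k arbitrary: p f)
  case 0
  then show ?case
    by (cases p) (simp_all add: newton_rem_def sum.lessThan_Suc_shift del: sum.lessThan_Suc)
next
  case (Suc k)
  then obtain q where "p = Suc q" "k < q"
    by (cases p) auto
  then show ?case
    using Suc.IH[of p f] Suc.IH[of q "fwd_diff f"] newton_rem_Suc_shift[of q f a "real k"]
    by (simp add: add.commute)
qed

lemma gbinomial_eq_prod_lessThan: "(x::real) gchoose p = (\<Prod>i<p. x - real i) / fact p"
  by (simp add: gbinomial_prod_rev lessThan_atLeast0)

lemma newton_rem_eq_divided_diff:
  assumes "x \<notin> real ` {..<p}"
  shows "newton_rem p f a x = (\<Prod>i<p. x - real i) * divided_diff f (insert (a + x) (grid a p))"
  using assms
proof (induction p)
  case 0
  then show ?case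
    by (simp add: newton_rem_def grid_def divided_diff_singleton)
next
  case (Suc p)
  have x: "x \<notin> real ` {..<p}" "x \<noteq> real p"
    using Suc.prems by (auto simp: lessThan_Suc)
  have "divided_diff f (insert (a + x) (grid a (Suc p))) =
      (divided_diff f (insert (a + x) (grid a p)) - divided_diff f (insert (a + real p) (grid a p)))
      / (a + x - (a + real p))"
    unfolding grid_Suc by (rule divided_diff_insert) (use x in \<open>auto simp: grid_def\<close>)
  then have "(x - real p) * divided_diff f (insert (a + x) (grid a (Suc p))) =
      divided_diff f (insert (a + x) (grid a p)) - (fwd_diff ^^ p) f a / fact p"
    using x(2) divided_diff_grid[of f a p] by (simp flip: grid_Suc)
  then have "(\<Prod>i<Suc p. x - real i) * divided_diff f (insert (a + x) (grid a (Suc p))) =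
      (\<Prod>i<p. x - real i) *
        (divided_diff f (insert (a + x) (grid a p)) - (fwd_diff ^^ p) f a / fact p)"
    by simp
  then show ?case
    using Suc.IH[OF x(1)] by (simp add: newton_rem_Suc gbinomial_eq_prod_lessThan algebra_simps)
qed

text \<open>The remainder is a multiple of the difference of two divided differences of order \<open>p\<close>. Their nodes
  all lie strictly between those of the grid that starts at \<open>b\<close>, which has its last node at \<open>b + p\<close>, and
  those of the grid that starts at \<open>b + K\<close>, so monotonicity puts both divided
  differences between the values of \<open>\<Delta>\<^sup>p f / p!\<close> at these two points.\<close>

lemma newton_rem_bound_convex:
  assumes conv: "p_convex_on (int p) {M<..} f" and "M < b" "x > 0"
    and K: "real p + 1 + real p < real K" "real p + 1 + x < real K"
  shows "\<bar>newton_rem (Suc p) f (b + real p + 1) x\<bar> \<le>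
    \<bar>\<Prod>i<p. x - real i\<bar> / fact p * ((fwd_diff ^^ p) f (b + real K) - (fwd_diff ^^ p) f b)"
proof -
  define a where "a = b + real p + 1"
  define L where "L = (fwd_diff ^^ p) f b / fact p"
  define U where "U = (fwd_diff ^^ p) f (b + real K) / fact p"
  have between: "L \<le> divided_diff f A \<and> divided_diff f A \<le> U"
    if "finite A" "card A = Suc p" "A \<subseteq> {a..<b + real K}" for A
  proof
    have "A \<subseteq> {M<..}"
      using that(3) \<open>M < b\<close> by (auto simp: a_def)
    moreover have "grid c (Suc p) \<subseteq> {M<..}" if "c \<ge> b" for c
      using that \<open>M < b\<close> by (auto simp: grid_def)
    ultimately show "L \<le> divided_diff f A" "divided_diff f A \<le> U"
      unfolding L_def U_def divided_diff_grid[symmetric]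
      by (auto intro!: p_convex_divided_diff_mono[OF conv] that finite_grid card_grid;
          use that(3) in \<open>force simp: grid_def a_def\<close>)+
  qed
  have grid: "L \<le> divided_diff f (grid a (Suc p)) \<and> divided_diff f (grid a (Suc p)) \<le> U"
    by (rule between[OF finite_grid card_grid]) (use K in \<open>auto simp: a_def grid_def\<close>)
  have "\<bar>newton_rem (Suc p) f a x\<bar> \<le> \<bar>\<Prod>i<p. x - real i\<bar> * (U - L)"
  proof (cases "x \<in> real ` {..<p}")
    case True
    then have "newton_rem (Suc p) f a x = 0"
      using newton_rem_node[of _ "Suc p" f a] by auto
    then show ?thesis
      using grid by simp
  next
    case False
    then have "a + x \<notin> grid a p"
      by (auto simp: grid_def)
    then have 1: "L \<le> divided_diff f (insert (a + x) (grid a p)) \<and>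
        divided_diff f (insert (a + x) (grid a p)) \<le> U"
      using K \<open>x > 0\<close>
      by (intro between) (simp add: finite_grid, simp add: finite_grid card_grid, auto simp: a_def grid_def)
    have "newton_rem (Suc p) f a x = (\<Prod>i<p. x - real i) *
        (divided_diff f (insert (a + x) (grid a p)) - divided_diff f (grid a (Suc p)))"
      using newton_rem_eq_divided_diff[OF False, of f a]
      by (simp add: newton_rem_Suc gbinomial_eq_prod_lessThan divided_diff_grid algebra_simps)
    then show ?thesis
      using grid 1 by (auto simp: abs_mult intro!: mult_left_mono)
  qed
  then show ?thesis
    by (simp add: a_def L_def U_def diff_divide_distrib[symmetric])
qed

text \<open>The constant \<open>C\<close> may be negative: this happens for concave \<open>f\<close>.\<close>

lemma newton_rem_bound:
  assumes "f \<in> K_class (int p)" "x > 0"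
  obtains C K where "\<forall>\<^sub>F n in sequentially. \<bar>newton_rem (Suc p) f (real (n + Suc p)) x\<bar> \<le>
    C * ((fwd_diff ^^ p) f (real (n + K)) - (fwd_diff ^^ p) f (real n))"
proof -
  obtain M where M: "p_convex_on (int p) {M<..} f \<or> p_convex_on (int p) {M<..} (\<lambda>t. - f t)"
    using assms(1) by (auto simp: K_class_def p_concave_on_def)
  obtain K :: nat where "max (real p + 1 + real p) (real p + 1 + x) < real K"
    using reals_Archimedean2 by blast
  then have K: "real p + 1 + real p < real K" "real p + 1 + x < real K"
    by auto
  obtain n0 :: nat where "M < real n0"
    using reals_Archimedean2 by blast
  then have ev: "\<forall>\<^sub>F n in sequentially. M < real n"
    by (auto simp: eventually_sequentially intro!: exI[of _ n0])
  define C where "C = \<bar>\<Prod>i<p. x - real i\<bar> / fact p"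
  from M show ?thesis
  proof
    assume conv: "p_convex_on (int p) {M<..} f"
    show ?thesis
    proof (rule that)
      show "\<forall>\<^sub>F n in sequentially. \<bar>newton_rem (Suc p) f (real (n + Suc p)) x\<bar> \<le>
          C * ((fwd_diff ^^ p) f (real (n + K)) - (fwd_diff ^^ p) f (real n))"
        using ev
      proof eventually_elim
        case (elim n)
        show ?case
          using newton_rem_bound_convex[OF conv elim \<open>x > 0\<close> K] by (simp add: C_def add_ac)
      qed
    qed
  next
    assume conv: "p_convex_on (int p) {M<..} (\<lambda>t. - f t)"
    show ?thesis
    proof (rule that)
      show "\<forall>\<^sub>F n in sequentially. \<bar>newton_rem (Suc p) f (real (n + Suc p)) x\<bar> \<le>
          (- C) * ((fwd_diff ^^ p) f (real (n + K)) - (fwd_diff ^^ p) f (real n))"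
        using ev
      proof eventually_elim
        case (elim n)
        show ?case
          using newton_rem_bound_convex[OF conv elim \<open>x > 0\<close> K]
          by (simp add: C_def add_ac newton_rem_uminus fwd_diff_funpow_uminus right_diff_distrib)
      qed
    qed
  qed
qed

text \<open>An increment of \<open>\<Delta>\<^sup>p f\<close> over the length \<open>K\<close> is a sum of \<open>K\<close> values of \<open>\<Delta>\<^sup>p\<^sup>+\<^sup>1 f\<close>.\<close>

lemma newton_rem_tendsto_0:
  assumes f: "f \<in> K_class (int p)" and D: "f \<in> D_class (Suc p)" and "x > 0"
  shows "(\<lambda>n. newton_rem (Suc p) f (real n) x) \<longlonglongrightarrow> 0"
proof -
  define b where "b n = (fwd_diff ^^ p) f (real n)" for n :: nat
  obtain C K where bound: "\<forall>\<^sub>F n in sequentially.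
      \<bar>newton_rem (Suc p) f (real (n + Suc p)) x\<bar> \<le> C * (b (n + K) - b n)"
    using newton_rem_bound[OF f \<open>x > 0\<close>] unfolding b_def .
  have step: "(\<lambda>n. b (Suc n) - b n) \<longlonglongrightarrow> 0"
    using D unfolding D_class_def mem_Collect_eq fwd_diff_funpow_Suc b_def of_nat_Suc
    by (simp only: add.commute)
  have "(\<lambda>n. b (n + K) - b n) \<longlonglongrightarrow> 0"
  proof (induction K)
    case (Suc K)
    have "(\<lambda>n. (b (Suc (n + K)) - b (n + K)) + (b (n + K) - b n)) \<longlonglongrightarrow> 0 + 0"
      by (intro tendsto_add Suc LIMSEQ_ignore_initial_segment[OF step])
    then show ?case
      by simp
  qed simp
  then have lim: "(\<lambda>n. C * (b (n + K) - b n)) \<longlonglongrightarrow> 0"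
    using tendsto_mult_right_zero by blast
  have "(\<lambda>n. newton_rem (Suc p) f (real (n + Suc p)) x) \<longlonglongrightarrow> 0"
    by (rule Lim_null_comparison[OF _ lim]) (use bound in simp)
  then show ?thesis
    by (rule LIMSEQ_offset)
qed

text \<open>The increments of \<open>\<Delta>\<^sup>p f\<close> over the length \<open>K\<close> split into \<open>K\<close> telescoping series. The bound of
  \<open>newton_rem_bound\<close> has no absolute value on its right-hand side, which makes it summable.\<close>

lemma newton_rem_summable:
  assumes f: "f \<in> K_class (int p)" and D: "f \<in> D_class p" and "x > 0"
  shows "summable (\<lambda>n. newton_rem (Suc p) f (real n) x)"
proof -
  define b where "b n = (fwd_diff ^^ p) f (real n)" for n :: nat
  obtain C K where bound: "\<forall>\<^sub>F n in sequentially.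
      \<bar>newton_rem (Suc p) f (real (n + Suc p)) x\<bar> \<le> C * (b (n + K) - b n)"
    using newton_rem_bound[OF f \<open>x > 0\<close>] unfolding b_def .
  have lim: "b \<longlonglongrightarrow> 0"
    using D unfolding D_class_def b_def[abs_def] by simp
  have "summable (\<lambda>n. b (n + K) - b n)"
  proof (induction K)
    case (Suc K)
    have "summable (\<lambda>n. b (Suc n + K) - b (n + K))"
      by (rule telescope_summable[OF LIMSEQ_ignore_initial_segment[OF lim]])
    from summable_add[OF this Suc] show ?case
      by simp
  qed simp
  then have "summable (\<lambda>n. C * (b (n + K) - b n))"
    by (rule summable_mult)
  then have "summable (\<lambda>n. newton_rem (Suc p) f (real (n + Suc p)) x)"
    by (rule summable_comparison_test_ev[rotated]) (use bound in simp)
  then show ?thesis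
    by (subst (asm) summable_iff_shift)
qed

section \<open>The approximants of the indefinite sum\<close>

text \<open>For \<open>g = ln\<close> and \<open>p = 1\<close> this is the logarithm of Gauss's limit for the Gamma function. The number
  \<open>j\<close> is smaller by one than in the usual notation, so that the order of the difference is not a
  truncated subtraction.\<close>

definition indef_sum_approx :: "nat \<Rightarrow> nat \<Rightarrow> (real \<Rightarrow> real) \<Rightarrow> real \<Rightarrow> real" where
  "indef_sum_approx p n g x = (\<Sum>k=1..<n. g (real k)) - (\<Sum>k<n. g (x + real k))
    + (\<Sum>j<p. (x gchoose Suc j) * (fwd_diff ^^ j) g (real n))"

lemma indef_sum_approx_sum:
  "indef_sum_approx p n (\<lambda>t. \<Sum>k\<in>S. h k t) x = (\<Sum>k\<in>S. indef_sum_approx p n (h k) x)"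
  unfolding indef_sum_approx_def fwd_diff_funpow_sum sum.distrib sum_subtractf sum_distrib_left
  by (simp add: sum.swap[of _ _ S])

lemma indef_sum_approx_Suc:
  assumes "n \<ge> 1"
  shows "indef_sum_approx p (Suc n) g x = indef_sum_approx p n g x - newton_rem (Suc p) g (real n) x"
proof -
  have "newton_rem (Suc p) g (real n) x = g (x + real n) - g (real n)
      - (\<Sum>j<p. (x gchoose Suc j) * (fwd_diff ^^ Suc j) g (real n))"
    by (simp add: newton_rem_def sum.lessThan_Suc_shift add.commute del: sum.lessThan_Suc)
  moreover have "(\<Sum>j<p. (x gchoose Suc j) * (fwd_diff ^^ Suc j) g (real n)) =
      (\<Sum>j<p. (x gchoose Suc j) * (fwd_diff ^^ j) g (real (Suc n)))
      - (\<Sum>j<p. (x gchoose Suc j) * (fwd_diff ^^ j) g (real n))"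
    by (simp add: fwd_diff_funpow_Suc right_diff_distrib sum_subtractf add.commute del: funpow.simps)
  ultimately show ?thesis
    using assms by (simp add: indef_sum_approx_def)
qed

lemma indef_sum_approx_shift:
  "indef_sum_approx p n g (x + 1) - indef_sum_approx p n g x = g x - newton_rem p g (real n) x"
proof -
  have "(\<Sum>k<n. g (x + real k)) + g (x + real n) = g x + (\<Sum>k<n. g (x + real (Suc k)))"
    using sum.lessThan_Suc[of "\<lambda>k. g (x + real k)" n]
      sum.lessThan_Suc_shift[of "\<lambda>k. g (x + real k)" n] by simp
  moreover have "(\<Sum>j<p. (x + 1 gchoose Suc j) * (fwd_diff ^^ j) g (real n)) =
      (\<Sum>j<p. (x gchoose Suc j) * (fwd_diff ^^ j) g (real n))
      + (\<Sum>j<p. (x gchoose j) * (fwd_diff ^^ j) g (real n))"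
    unfolding gbinomial_Suc_Suc distrib_right sum.distrib by simp
  ultimately show ?thesis
    by (simp add: indef_sum_approx_def newton_rem_def add_ac)
qed

text \<open>The additional summands contain differences \<open>\<Delta>\<^sup>j g (n)\<close> with \<open>j \<ge> p\<close> only.\<close>

lemma indef_sum_approx_tendsto_mono:
  assumes g: "g \<in> D_class p" and "p \<le> q" and lim: "(\<lambda>n. indef_sum_approx p n g x) \<longlonglongrightarrow> l"
  shows "(\<lambda>n. indef_sum_approx q n g x) \<longlonglongrightarrow> l"
proof -
  have "(\<lambda>n. (fwd_diff ^^ j) g (real n)) \<longlonglongrightarrow> 0" if "j \<in> {p..<q}" for j
    using D_class_mono[of p j] g that by (auto simp: D_class_def)
  then have "(\<lambda>n. \<Sum>j\<in>{p..<q}. (x gchoose Suc j) * (fwd_diff ^^ j) g (real n)) \<longlonglongrightarrow>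
      (\<Sum>j\<in>{p..<q}. (x gchoose Suc j) * 0)"
    by (intro tendsto_sum tendsto_mult tendsto_const)
  from tendsto_add[OF lim this]
  have "(\<lambda>n. indef_sum_approx p n g x
      + (\<Sum>j\<in>{p..<q}. (x gchoose Suc j) * (fwd_diff ^^ j) g (real n))) \<longlonglongrightarrow> l"
    by simp
  moreover have "(\<Sum>j<q. (x gchoose Suc j) * (fwd_diff ^^ j) g (real n)) =
      (\<Sum>j<p. (x gchoose Suc j) * (fwd_diff ^^ j) g (real n))
      + (\<Sum>j\<in>{p..<q}. (x gchoose Suc j) * (fwd_diff ^^ j) g (real n))" for n
    unfolding lessThan_atLeast0
    by (rule sum.atLeastLessThan_concat[symmetric]) (use \<open>p \<le> q\<close> in auto)
  ultimately show ?thesis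
    by (simp add: indef_sum_approx_def add.assoc)
qed

text \<open>Both sums of an approximant telescope, and \<open>f x - f 1\<close> and the approximant differ by a Newton
  remainder of \<open>f\<close>. Since the shape condition is on \<open>f\<close>, the lemma applies to \<open>g = \<Delta> f\<close> for every
  \<open>f\<close> in \<open>D_class p \<inter> K_class p\<close>.\<close>

lemma indef_sum_approx_tendsto_antidifference:
  assumes f: "f \<in> K_class (int p)" and diff: "\<And>t. t > 0 \<Longrightarrow> fwd_diff f t = g t"
    and g: "g \<in> D_class p" and "x > 0"
  shows "(\<lambda>n. indef_sum_approx p n g x) \<longlonglongrightarrow> f x - f 1"
proof -
  have "fwd_diff f \<in> D_class p"
    using D_class_cong[OF diff] g by simp
  then have "f \<in> D_class (Suc p)"
    by (simp add: D_class_def fwd_diff_funpow_fwd_diff del: funpow.simps)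
  from tendsto_diff[OF tendsto_const newton_rem_tendsto_0[OF f this \<open>x > 0\<close>]]
  have lim: "(\<lambda>n. f x - f 1 - newton_rem (Suc p) f (real n) x) \<longlonglongrightarrow> f x - f 1"
    by simp
  have "indef_sum_approx p n g x = f x - f 1 - newton_rem (Suc p) f (real n) x" if "n \<ge> 1" for n
  proof -
    have "(\<Sum>k=1..<n. g (real k)) = (\<Sum>k=1..<n. f (real (Suc k)) - f (real k))"
      by (intro sum.cong) (auto simp: fwd_diff_def add.commute simp flip: diff)
    also have "\<dots> = f (real n) - f 1"
      using sum_Suc_diff'[of 1 n "\<lambda>k. f (real k)"] that by simp
    finally have 1: "(\<Sum>k=1..<n. g (real k)) = f (real n) - f 1" .
    have "(\<Sum>k<n. g (x + real k)) = (\<Sum>k<n. f (x + real (Suc k)) - f (x + real k))"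
      using \<open>x > 0\<close> by (intro sum.cong) (auto simp: fwd_diff_def add_ac simp flip: diff)
    also have "\<dots> = f (x + real n) - f x"
      using sum_lessThan_telescope[of "\<lambda>k. f (x + real k)" n] by simp
    finally have 2: "(\<Sum>k<n. g (x + real k)) = f (x + real n) - f x" .
    have 3: "(fwd_diff ^^ j) g (real n) = (fwd_diff ^^ Suc j) f (real n)" for j
      using fwd_diff_funpow_cong[of "fwd_diff f" g "real n" j] diff that
      by (simp add: fwd_diff_funpow_fwd_diff del: funpow.simps)
    have "newton_rem (Suc p) f (real n) x = f (x + real n) - f (real n)
        - (\<Sum>j<p. (x gchoose Suc j) * (fwd_diff ^^ Suc j) f (real n))"
      by (simp add: newton_rem_def sum.lessThan_Suc_shift add.commute del: sum.lessThan_Suc)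
    then show ?thesis
      unfolding indef_sum_approx_def 1 2 3 by simp
  qed
  then have "\<forall>\<^sub>F n in sequentially. indef_sum_approx p n g x =
      f x - f 1 - newton_rem (Suc p) f (real n) x"
    by (auto simp: eventually_sequentially)
  from tendsto_cong[OF this] lim show ?thesis
    by blast
qed

text \<open>Consecutive approximants differ by a term of a summable series.\<close>

lemma indef_sum_approx_convergent:
  assumes "g \<in> D_class p" "g \<in> K_class (int p)" "x > 0"
  shows "convergent (\<lambda>n. indef_sum_approx p n g x)"
proof -
  let ?r = "\<lambda>n. newton_rem (Suc p) g (real n) x"
  have "indef_sum_approx p (Suc n) g x = indef_sum_approx p 1 g x + ?r 0 - (\<Sum>k<Suc n. ?r k)" for n
    by (induction n) (simp_all add: indef_sum_approx_Suc)
  moreover have "convergent (\<lambda>n. \<Sum>k<n. ?r k)"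
    using newton_rem_summable[OF assms(2,1,3)] by (simp add: summable_iff_convergent)
  then have "convergent (\<lambda>n. indef_sum_approx p 1 g x + ?r 0 - (\<Sum>k<Suc n. ?r k))"
    by (intro convergent_diff convergent_const
        convergent_Suc_iff[of "\<lambda>n. \<Sum>k<n. ?r k", THEN iffD2])
  ultimately have "convergent (\<lambda>n. indef_sum_approx p (Suc n) g x)"
    by presburger
  then show ?thesis
    by (rule convergent_Suc_iff[THEN iffD1])
qed

text \<open>An approximant is a constant minus a sum of translates of \<open>g\<close>, up to a polynomial of degree at most
  \<open>p\<close>, which divided differences of order \<open>p + 1\<close> do not see.\<close>

lemma indef_sum_approx_divided_diff:
  assumes "card A = p + 2"
  shows "divided_diff (\<lambda>x. indef_sum_approx p n g x) A =
    - (\<Sum>k<n. divided_diff g ((\<lambda>x. x + real k) ` A))"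
proof -
  have "(\<lambda>x. indef_sum_approx p n g x) = (\<lambda>x. (\<Sum>k=1..<n. g (real k)) + ((-1) * (\<Sum>k<n. g (x + real k))
      + (\<Sum>j<p. (fwd_diff ^^ j) g (real n) * (x gchoose Suc j))))"
    by (rule ext) (simp add: indef_sum_approx_def mult.commute)
  then show ?thesis
    using assms
    by (simp only: divided_diff_add divided_diff_sum divided_diff_cmult divided_diff_translate)
      (simp add: divided_diff_const divided_diff_gbinomial)
qed

lemma p_concave_on_limit_indef_sum_approx:
  assumes conv: "p_convex_on (int p) {M<..} g"
    and lim: "\<And>x. x > M \<Longrightarrow> (\<lambda>n. indef_sum_approx p n g x) \<longlonglongrightarrow> f x"
  shows "p_convex_on (int p) {M<..} (\<lambda>t. - f t)"
  unfolding p_convex_on_def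
proof (intro allI impI, elim conjE)
  fix A
  assume A: "finite A" "A \<subseteq> {M<..}" "int (card A) = int p + 2"
  have "(\<lambda>n. divided_diff (\<lambda>x. indef_sum_approx p n g x) A) \<longlonglongrightarrow> divided_diff f A"
    using A(2) by (intro tendsto_divided_diff lim) auto
  moreover have "divided_diff (\<lambda>x. indef_sum_approx p n g x) A \<le> 0" for n
  proof -
    have "divided_diff g ((\<lambda>x. x + real k) ` A) \<ge> 0" for k
    proof -
      have "card ((\<lambda>x. x + real k) ` A) = card A"
        by (intro card_image) simp
      moreover have "(\<lambda>x. x + real k) ` A \<subseteq> {M<..}"
        using A(2) by force
      ultimately show ?thesis
        using conv A by (simp add: p_convex_on_def)
    qed
    moreover have "card A = p + 2"
      using A(3) by linarith
    ultimately show ?thesis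
      by (simp add: indef_sum_approx_divided_diff sum_nonneg)
  qed
  ultimately have "divided_diff f A \<le> 0"
    by (intro LIMSEQ_le_const2) auto
  then show "0 \<le> divided_diff (\<lambda>t. - f t) A"
    by (simp add: divided_diff_uminus)
qed

lemma indef_sum_approx_uminus:
  "indef_sum_approx p n (\<lambda>t. - g t) x = - indef_sum_approx p n g x"
  by (simp add: indef_sum_approx_def fwd_diff_funpow_uminus sum_negf)

lemma limit_indef_sum_approx_mem_K_class:
  assumes g: "g \<in> K_class (int p)"
    and lim: "\<And>x. x > 0 \<Longrightarrow> (\<lambda>n. indef_sum_approx p n g x) \<longlonglongrightarrow> f x"
  shows "f \<in> K_class (int p)"
proof -
  obtain M where M: "M \<ge> 0"
    "p_convex_on (int p) {M<..} g \<or> p_convex_on (int p) {M<..} (\<lambda>t. - g t)"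
    using g by (auto simp: K_class_def p_concave_on_def)
  have "p_convex_on (int p) {M<..} (\<lambda>t. - f t)" if "p_convex_on (int p) {M<..} g"
    by (rule p_concave_on_limit_indef_sum_approx[OF that]) (use lim M in auto)
  moreover have "p_convex_on (int p) {M<..} (\<lambda>t. - (- f t))"
    if "p_convex_on (int p) {M<..} (\<lambda>t. - g t)"
    by (rule p_concave_on_limit_indef_sum_approx[OF that])
      (use lim M in \<open>auto simp: indef_sum_approx_uminus intro: tendsto_minus\<close>)
  ultimately show ?thesis
    using M by (auto simp: K_class_def p_concave_on_def)
qed

section \<open>The indefinite sum\<close>

text \<open>Existence: the step of the approximants in \<open>x\<close> misses \<open>g x\<close> by a remainder that tends to \<open>0\<close>, so
  that their limit solves the difference equation.\<close>

lemma indef_sum_solution_exists: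
  assumes D: "g \<in> D_class p" and K: "g \<in> K_class (int p)"
  obtains f where "f \<in> K_class (int p)" "\<And>x. x > 0 \<Longrightarrow> fwd_diff f x = g x" "f 1 = 0"
    "\<And>x. x \<le> 0 \<Longrightarrow> f x = 0"
proof -
  define f where "f x = (if x > 0 then lim (\<lambda>n. indef_sum_approx p n g x) else 0)" for x
  have lim: "(\<lambda>n. indef_sum_approx p n g x) \<longlonglongrightarrow> f x" if "x > 0" for x
    using indef_sum_approx_convergent[OF D K that] that by (simp add: f_def convergent_LIMSEQ_iff)
  have Dlim: "(\<lambda>n. (fwd_diff ^^ p) g (real n)) \<longlonglongrightarrow> 0"
    using D by (simp add: D_class_def)
  show ?thesis
  proof (rule that)
    show "f \<in> K_class (int p)"
      by (rule limit_indef_sum_approx_mem_K_class[OF K lim])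
    show "fwd_diff f x = g x" if "x > 0" for x
    proof -
      have "(\<lambda>n. newton_rem (Suc p) g (real n) x + (x gchoose p) * (fwd_diff ^^ p) g (real n))
          \<longlonglongrightarrow> 0 + (x gchoose p) * 0"
        by (intro tendsto_intros Dlim summable_LIMSEQ_zero newton_rem_summable K D that)
      then have "(\<lambda>n. newton_rem p g (real n) x) \<longlonglongrightarrow> 0"
        by (simp add: newton_rem_Suc)
      from tendsto_diff[OF tendsto_const this]
      have "(\<lambda>n. indef_sum_approx p n g (x + 1) - indef_sum_approx p n g x) \<longlonglongrightarrow> g x"
        by (simp add: indef_sum_approx_shift)
      moreover have "(\<lambda>n. indef_sum_approx p n g (x + 1) - indef_sum_approx p n g x)
          \<longlonglongrightarrow> f (x + 1) - f x"
        using that by (intro tendsto_diff lim) auto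
      ultimately show ?thesis
        unfolding fwd_diff_def by (rule LIMSEQ_unique[rotated])
    qed
    show "f 1 = 0"
    proof -
      \<comment> \<open>At \<open>x = 1\<close> the approximant is \<open>- g n\<close> for \<open>p = 0\<close>, and \<open>0\<close> otherwise.\<close>
      have "indef_sum_approx p n g 1 = (if p = 0 then - g (real n) else 0)" if "n \<ge> 1" for n
      proof -
        have "(\<Sum>k<n. g (1 + real k)) = (\<Sum>k=1..<Suc n. g (real k))"
          using sum.shift_bounds_Suc_ivl[of "\<lambda>k. g (real k)" 0 n] by (simp add: lessThan_atLeast0)
        moreover have "((1::real) gchoose Suc j) = (if j = 0 then 1 else 0)" for j
          using binomial_gbinomial[of 1 "Suc j", where 'a = real] by (cases j) simp_all
        ultimately show ?thesis
          using that by (simp add: indef_sum_approx_def if_distrib[of "\<lambda>c. c * _"] cong: if_cong)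
      qed
      then have ev: "\<forall>\<^sub>F n in sequentially.
          indef_sum_approx p n g 1 = (if p = 0 then - g (real n) else 0)"
        unfolding eventually_sequentially by blast
      have "(\<lambda>n. if p = 0 then - g (real n) else 0) \<longlonglongrightarrow> 0"
        using Dlim tendsto_minus[of "\<lambda>n. g (real n)" 0 sequentially] by (cases "p = 0") auto
      then have "(\<lambda>n. indef_sum_approx p n g 1) \<longlonglongrightarrow> 0"
        using tendsto_cong[OF ev] by blast
      with lim[of 1] show ?thesis
        using LIMSEQ_unique by force
    qed
  qed (simp add: f_def)
qed

lemma indef_sum_characterization:
  assumes g: "g \<in> D_class p" "g \<in> K_class (int p)"
  shows "indef_sum g \<in> K_class (int p)" "\<And>x. x > 0 \<Longrightarrow> fwd_diff (indef_sum g) x = g x"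
    "indef_sum g 1 = 0"
proof -
  let ?P = "\<lambda>f. (\<exists>q::nat. g \<in> D_class q \<inter> K_class (int q) \<and> f \<in> K_class (int q)) \<and>
    (\<forall>x>0. fwd_diff f x = g x) \<and> f 1 = 0 \<and> (\<forall>x\<le>0. f x = 0)"
  obtain f where f: "f \<in> K_class (int p)" "\<And>x. x > 0 \<Longrightarrow> fwd_diff f x = g x" "f 1 = 0"
    "\<And>x. x \<le> 0 \<Longrightarrow> f x = 0"
    using indef_sum_solution_exists[OF g] by metis
  \<comment> \<open>A competitor \<open>h\<close> may come with another order; both are limits of the approximants of the
    larger one.\<close>
  have limits: "\<exists>q. (\<lambda>n. indef_sum_approx q n g x) \<longlonglongrightarrow> h x \<and>
      (\<lambda>n. indef_sum_approx q n g x) \<longlonglongrightarrow> f x" if h: "?P h" and "x > 0" for h x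
  proof -
    obtain q where q: "g \<in> D_class q" "h \<in> K_class (int q)"
      using h by auto
    have "(\<lambda>n. indef_sum_approx q n g x) \<longlonglongrightarrow> h x - h 1"
      using q h \<open>x > 0\<close> by (intro indef_sum_approx_tendsto_antidifference) auto
    from indef_sum_approx_tendsto_mono[OF q(1) max.cobounded2 this, of p]
    have "(\<lambda>n. indef_sum_approx (max p q) n g x) \<longlonglongrightarrow> h x"
      using h by simp
    moreover have "(\<lambda>n. indef_sum_approx p n g x) \<longlonglongrightarrow> f x - f 1"
      using f g \<open>x > 0\<close> by (intro indef_sum_approx_tendsto_antidifference) auto
    from indef_sum_approx_tendsto_mono[OF g(1) max.cobounded1 this, of q]
    have "(\<lambda>n. indef_sum_approx (max p q) n g x) \<longlonglongrightarrow> f x"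
      using f by simp
    ultimately show ?thesis
      by blast
  qed
  have "indef_sum g = f"
    unfolding indef_sum_def
  proof (rule the_equality)
    show "?P f"
      using f g by auto
    show "h = f" if h: "?P h" for h
    proof
      fix x :: real
      show "h x = f x"
        using limits[OF h, of x] LIMSEQ_unique h f(4) by (cases "x > 0") (blast, simp)
    qed
  qed
  then show "indef_sum g \<in> K_class (int p)" "indef_sum g 1 = 0"
      "\<And>x. x > 0 \<Longrightarrow> fwd_diff (indef_sum g) x = g x"
    using f by auto
qed

lemma indef_sum_approx_tendsto_indef_sum:
  assumes g: "g \<in> D_class p" "g \<in> K_class (int p)" and "p \<le> q" "x > 0"
  shows "(\<lambda>n. indef_sum_approx q n g x) \<longlonglongrightarrow> indef_sum g x"
  using indef_sum_approx_tendsto_mono[OF g(1) \<open>p \<le> q\<close>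
      indef_sum_approx_tendsto_antidifference[OF indef_sum_characterization(1,2)[OF g] g(1) \<open>x > 0\<close>]]
    indef_sum_characterization(3)[OF g] by simp

lemma indef_sum_cong:
  assumes "\<And>t. t > 0 \<Longrightarrow> g t = h t"
  shows "indef_sum g = indef_sum h"
proof -
  have "(\<forall>x>0. fwd_diff f x = g x) \<longleftrightarrow> (\<forall>x>0. fwd_diff f x = h x)" for f
    using assms by auto
  then show ?thesis
    unfolding indef_sum_def using D_class_cong[OF assms] K_class_cong[OF assms] by auto
qed

lemma fwd_diff_indef_sum_funpow:
  assumes "g \<in> dom_indef_sum_iter m" "k \<le> m" "t > 0"
  shows "(fwd_diff ^^ k) ((indef_sum ^^ m) g) t = (indef_sum ^^ (m - k)) g t"
  using assms
proof (induction k arbitrary: m)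
  case (Suc k)
  then obtain i where i: "m = Suc i" "k \<le> i"
    by (cases m) auto
  with Suc.prems obtain p :: nat where p: "(indef_sum ^^ i) g \<in> D_class p \<inter> K_class (int p)"
    by (auto simp: dom_indef_sum_def)
  have "(fwd_diff ^^ Suc k) ((indef_sum ^^ m) g) t =
      (fwd_diff ^^ k) (fwd_diff (indef_sum ((indef_sum ^^ i) g))) t"
    by (simp add: i fwd_diff_funpow_fwd_diff del: funpow.simps(2)) simp
  also have "\<dots> = (fwd_diff ^^ k) ((indef_sum ^^ i) g) t"
    using p indef_sum_characterization(2) \<open>t > 0\<close> by (intro fwd_diff_funpow_cong) auto
  also have "\<dots> = (indef_sum ^^ (m - Suc k)) g t"
    using Suc i by simp
  finally show ?case .
qed simp

lemma indef_sum_funpow_at_1: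
  assumes "g \<in> dom_indef_sum_iter m" "m > 0"
  shows "(indef_sum ^^ m) g 1 = 0"
proof -
  obtain i where "m = Suc i"
    using assms(2) by (cases m) auto
  then obtain p :: nat where "(indef_sum ^^ i) g \<in> D_class p \<inter> K_class (int p)"
    using assms(1) by (auto simp: dom_indef_sum_def)
  then show ?thesis
    using \<open>m = Suc i\<close> indef_sum_characterization(3) by auto
qed

lemma dom_indef_sum_iter_antimono:
  assumes "i \<le> m"
  shows "dom_indef_sum_iter m \<subseteq> dom_indef_sum_iter i"
  using assms by (induction m rule: dec_induct) auto

text \<open>Telescoping of the discrete product rule: since \<open>\<Delta>\<^sub>t (x - t gchoose k)\<close> is
  \<open>- (x - 1 - t gchoose (k - 1))\<close>, the function \<open>t \<mapsto> (x - t gchoose k) \<cdot> \<Delta>\<^sup>k f t\<close> has difference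
  \<open>u k - u (k - 1)\<close>, where \<open>u k t = (x - 1 - t gchoose k) \<cdot> \<Delta>\<^sup>k\<^sup>+\<^sup>1 f t\<close> and \<open>u (-1) = 0\<close>.\<close>

lemma sum_fwd_diff_gbinomial_mult:
  "(\<Sum>k\<le>m. fwd_diff (\<lambda>t. ((x - t) gchoose k) * (fwd_diff ^^ k) f t) t) =
    ((x - 1 - t) gchoose m) * (fwd_diff ^^ Suc m) f t"
proof (induction m)
  case 0
  then show ?case
    by (simp add: fwd_diff_def)
next
  case (Suc m)
  have "((x - t) gchoose Suc m) = ((x - 1 - t) gchoose m) + ((x - 1 - t) gchoose Suc m)"
    using gbinomial_Suc_Suc[of "x - 1 - t" m] by simp
  moreover have "x - (t + 1) = x - 1 - t"
    by simp
  ultimately have "fwd_diff (\<lambda>t. ((x - t) gchoose Suc m) * (fwd_diff ^^ Suc m) f t) t =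
      ((x - 1 - t) gchoose Suc m) * (fwd_diff ^^ Suc (Suc m)) f t
      - ((x - 1 - t) gchoose m) * (fwd_diff ^^ Suc m) f t"
    unfolding fwd_diff_funpow_Suc[of "Suc m"]
    by (simp only: fwd_diff_def[of "\<lambda>t. _ t * _ t"]) (simp add: algebra_simps del: funpow.simps)
  then show ?case
    using Suc.IH by (simp del: funpow.simps)
qed

theorem corollary7p3:
  fixes m :: nat and x :: real and f g :: "real \<Rightarrow> real"
  assumes "x > 0"
    and "g \<in> dom_indef_sum_iter (m + 1)"
    and "f = (indef_sum ^^ (m + 1)) g"
    and "\<And>k. k \<le> m \<Longrightarrow>
      (\<lambda>t. ((x - 1 - t) gchoose k) * (fwd_diff ^^ (k + 1)) f t) \<in> dom_indef_sum"
    and "\<And>k. k \<le> m \<Longrightarrow>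
      \<exists>p::nat. p \<ge> 1 \<and>
        (\<lambda>t. ((x - t) gchoose k) * (fwd_diff ^^ k) f t) \<in> D_class p \<inter> K_class (int p)"
  shows "(indef_sum ^^ (m + 1)) g x = indef_sum (\<lambda>t. ((x - t - 1) gchoose m) * g t) x"
proof -
  define h where "h k t = ((x - t) gchoose k) * (fwd_diff ^^ k) f t" for k t
  define u where "u t = ((x - 1 - t) gchoose m) * (fwd_diff ^^ Suc m) f t" for t
  have u_eq: "u = (\<lambda>t. \<Sum>k\<le>m. fwd_diff (h k) t)"
    unfolding u_def h_def sum_fwd_diff_gbinomial_mult ..
  obtain p where p: "\<And>k. k \<le> m \<Longrightarrow> h k \<in> D_class (p k) \<inter> K_class (int (p k))"
    using assms(5) unfolding h_def by metis
  obtain r where r: "u \<in> D_class r" "u \<in> K_class (int r)"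
    using assms(4)[of m] unfolding u_def[abs_def] dom_indef_sum_def by auto
  \<comment> \<open>A common order makes the approximants of \<open>u\<close> the sum of those of its summands.\<close>
  define q where "q = Max (insert r (p ` {..m}))"
  have "r \<le> q"
    unfolding q_def by (intro Max_ge) auto
  have pq: "p k \<le> q" if "k \<le> m" for k
    unfolding q_def using that by (intro Max_ge) auto
  have summand: "(\<lambda>n. indef_sum_approx q n (fwd_diff (h k)) x) \<longlonglongrightarrow> h k x - h k 1"
    if "k \<le> m" for k
  proof (rule indef_sum_approx_tendsto_mono[OF _ pq[OF that]])
    show D: "fwd_diff (h k) \<in> D_class (p k)"
      using p[OF that] by (intro fwd_diff_mem_D_class) auto
    show "(\<lambda>n. indef_sum_approx (p k) n (fwd_diff (h k)) x) \<longlonglongrightarrow> h k x - h k 1"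
      using p[OF that] D \<open>x > 0\<close> by (intro indef_sum_approx_tendsto_antidifference) auto
  qed
  have boundary: "h k x - h k 1 = (if k = 0 then f x else 0)" if "k \<le> m" for k
  proof -
    have "(fwd_diff ^^ k) f 1 = (indef_sum ^^ (m + 1 - k)) g 1"
      unfolding assms(3) using that assms(2) by (intro fwd_diff_indef_sum_funpow) auto
    also have "\<dots> = 0"
      using dom_indef_sum_iter_antimono[of "m + 1 - k" "m + 1"] assms(2) that
      by (intro indef_sum_funpow_at_1) auto
    finally show ?thesis
      by (cases k) (simp_all add: h_def)
  qed
  have "(\<lambda>n. indef_sum_approx q n u x) \<longlonglongrightarrow> (\<Sum>k\<le>m. h k x - h k 1)"
    unfolding u_eq indef_sum_approx_sum by (intro tendsto_sum summand) simp
  also have "(\<Sum>k\<le>m. h k x - h k 1) = f x"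
    by (simp add: boundary)
  finally have "indef_sum u x = f x"
    using indef_sum_approx_tendsto_indef_sum[OF r \<open>r \<le> q\<close> \<open>x > 0\<close>] LIMSEQ_unique by blast
  moreover have "indef_sum u = indef_sum (\<lambda>t. ((x - t - 1) gchoose m) * g t)"
  proof (rule indef_sum_cong)
    fix t :: real
    assume "t > 0"
    then have "(fwd_diff ^^ Suc m) f t = g t"
      using fwd_diff_indef_sum_funpow[OF assms(2), of "Suc m" t] assms(3) by simp
    moreover have "x - 1 - t = x - t - 1"
      by simp
    ultimately show "u t = ((x - t - 1) gchoose m) * g t"
      by (simp only: u_def)
  qed
  ultimately show ?thesis
    using assms(3) by simp
qed

end
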